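(* The sequence $\mathcal Q=\{\Bbbk Q_n\}_{n\ge1}$ is a non-symmetric operad under the structure maps $$F_{\mathsf S}\circ_iF_{\mathsf T}:=F_{B_i(\mathsf S,\mathsf T)}\qquad(\mathsf S\subseteq[n-1],\ \mathsf T\subseteq[m-1],\ 1\le i\le n).$$ Moreover, the map $\mathsf D:\mathcal A\to\mathcal Q$, $\mathsf D(F_\sigma):=F_{\mathrm{Des}(\sigma)}$, is a surjective morphism of non-symmetric operads.
   Context: $\Bbbk$ is a commutative ring; "space" means $\Bbbk$-module. $[n]=\{1,\dots,n\}$ (with $[0]=\emptyset$). A non-symmetric (unital) operad is a sequence of spaces $\{\mathcal P_n\}_{n\ge1}$ with linear maps $\circ_i:\mathcal P_n\otimes\mathcal P_m\to\mathcal P_{n+m-1}$ ($n,m\ge1$, $1\le i\le n$) and an element $1\in\mathcal P_1$ such that for $x\in\mathcal P_n,y\in\mathcal P_m,z\in\mathcal P_l$: $(x\circ_iy)\circ_{j+m-1}z=(x\circ_jz)\circ_iy$ if $1\le i<j\le n$; $(x\circ_iy)\circ_{i+j-1}z=x\circ_i(y\circ_jz)$ if $1\le i\le n$, $1\le j\le m$; $x\circ_i1=x$; $1\circ_1x=x$. A morphism is a sequence of linear maps preserving all $\circ_i$ and the unit. Operad $\mathcal A$. $\mathcal A_n:=\Bbbk S_n$ with basis $\{F_\sigma\}$ and $F_\sigma\circ_iF_\tau=F_{B_i(\sigma,\tau)}$, unit $F_{(1)}$, where for $\sigma\in S_n,\tau\in S_m$, $B_i(\sigma,\tau):=(a_1,\dots,a_{i-1},b_1,\dots,b_m,a_{i+1},\dots,a_n)$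 with $a_j=\sigma_j$ if $\sigma_j<\sigma_i$, $a_j=\sigma_j+m-1$ if $\sigma_j>\sigma_i$, $b_k=\tau_k+\sigma_i-1$. Sets. $Q_n$ is the set of subsets of $[n-1]$; $\Bbbk Q_n$ has basis $\{F_{\mathsf S}\}_{\mathsf S\subseteq[n-1]}$; the unit of $\mathcal Q$ is $F_\emptyset\in\Bbbk Q_1$. $\mathsf S+p:=\{s+p:s\in\mathsf S\}$, and $$B_i(\mathsf S,\mathsf T):=(\mathsf S\cap\{1,\dots,i-1\})\cup(\mathsf T+i-1)\cup\bigl((\mathsf S\cap\{i,\dots,n-1\})+m-1\bigr)\subseteq[n+m-2].$$ $\mathrm{Des}(\sigma)=\{p\in[n-1]:\sigma_p>\sigma_{p+1}\}$ for $\sigma\in S_n$. *)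

theory Defs
  imports "HOL-Algebra.Module" "HOL-Combinatorics.Multiset_Permutations" "HOL-Library.FuncSet"
begin

section \<open>Linear maps and free modules of finite rank\<close>

definition linear_map ::
  "('k, 'r) ring_scheme \<Rightarrow> ('k, 'a, 'm) module_scheme \<Rightarrow> ('k, 'b, 'n) module_scheme \<Rightarrow> ('a \<Rightarrow> 'b) \<Rightarrow> bool"
where
  "linear_map R M N f \<longleftrightarrow>
     f \<in> carrier M \<rightarrow> carrier N \<and>
     (\<forall>x\<in>carrier M. \<forall>y\<in>carrier M. f (x \<oplus>\<^bsub>M\<^esub> y) = f x \<oplus>\<^bsub>N\<^esub> f y) \<and>
     (\<forall>r\<in>carrier R. \<forall>x\<in>carrier M. f (r \<odot>\<^bsub>M\<^esub> x) = r \<odot>\<^bsub>N\<^esub> f x)"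

text \<open>A bilinear map \<open>M \<times> N \<rightarrow> L\<close> stands for a linear map \<open>M \<otimes> N \<rightarrow> L\<close>.\<close>

definition bilinear_map ::
  "('k, 'r) ring_scheme \<Rightarrow> ('k, 'a, 'm) module_scheme \<Rightarrow> ('k, 'b, 'n) module_scheme \<Rightarrow>
   ('k, 'c, 'l) module_scheme \<Rightarrow> ('a \<Rightarrow> 'b \<Rightarrow> 'c) \<Rightarrow> bool"
where
  "bilinear_map R M N L f \<longleftrightarrow>
     (\<forall>x\<in>carrier M. linear_map R N L (f x)) \<and>
     (\<forall>y\<in>carrier N. linear_map R M L (\<lambda>x. f x y))"

text \<open>
  The free module on a finite set \<open>X\<close>: an element is its family of coordinates, so for infinite
  \<open>X\<close> this would be the direct product instead. The fields \<open>mult\<close> and \<open>one\<close>, which the record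
  type of modules inherits from rings, carry no meaning.
\<close>

definition free_module :: "('k, 'r) ring_scheme \<Rightarrow> 'b set \<Rightarrow> ('k, 'b \<Rightarrow> 'k) module" where
  "free_module R X =
     \<lparr>carrier = X \<rightarrow>\<^sub>E carrier R,
      monoid.mult = undefined,
      monoid.one = undefined,
      zero = (\<lambda>s\<in>X. \<zero>\<^bsub>R\<^esub>),
      add = (\<lambda>x y. \<lambda>s\<in>X. x s \<oplus>\<^bsub>R\<^esub> y s),
      smult = (\<lambda>r x. \<lambda>s\<in>X. r \<otimes>\<^bsub>R\<^esub> x s)\<rparr>"

text \<open>The basis element \<open>F\<^sub>s\<close> of \<open>free_module R X\<close>; meaningful for \<open>s \<in> X\<close>.\<close>

definition basis_elem :: "('k, 'r) ring_scheme \<Rightarrow> 'b set \<Rightarrow> 'b \<Rightarrow> 'b \<Rightarrow> 'k" where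
  "basis_elem R X s = (\<lambda>t\<in>X. if t = s then \<one>\<^bsub>R\<^esub> else \<zero>\<^bsub>R\<^esub>)"

text \<open>
  The linear map \<open>F\<^sub>s \<mapsto> F\<^bsub>\<phi> s\<^esub>\<close> and the bilinear map \<open>(F\<^sub>s, F\<^sub>t) \<mapsto> F\<^bsub>\<beta> s t\<^esub>\<close>.
\<close>

definition linear_extension ::
  "('k, 'r) ring_scheme \<Rightarrow> 'b set \<Rightarrow> 'c set \<Rightarrow> ('b \<Rightarrow> 'c) \<Rightarrow> ('b \<Rightarrow> 'k) \<Rightarrow> ('c \<Rightarrow> 'k)"
where
  "linear_extension R X Z \<phi> x =
     (\<Oplus>\<^bsub>free_module R Z\<^esub>s\<in>X. x s \<odot>\<^bsub>free_module R Z\<^esub> basis_elem R Z (\<phi> s))"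

definition bilinear_extension ::
  "('k, 'r) ring_scheme \<Rightarrow> 'b set \<Rightarrow> 'c set \<Rightarrow> 'd set \<Rightarrow> ('b \<Rightarrow> 'c \<Rightarrow> 'd) \<Rightarrow>
   ('b \<Rightarrow> 'k) \<Rightarrow> ('c \<Rightarrow> 'k) \<Rightarrow> ('d \<Rightarrow> 'k)"
where
  "bilinear_extension R X Y Z \<beta> x y =
     (\<Oplus>\<^bsub>free_module R Z\<^esub>p\<in>X \<times> Y.
        (x (fst p) \<otimes>\<^bsub>R\<^esub> y (snd p)) \<odot>\<^bsub>free_module R Z\<^esub> basis_elem R Z (\<beta> (fst p) (snd p)))"


section \<open>Non-symmetric operads\<close>

text \<open>
  \<open>pcomp P n m i x y\<close> is \<open>x \<circ>\<^sub>i y\<close> for \<open>x\<close> of arity \<open>n\<close> and \<open>y\<close> of arity \<open>m\<close>. Only the values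
  at arities \<open>n, m \<ge> 1\<close> and positions \<open>1 \<le> i \<le> n\<close> matter; \<open>space P 0\<close> is ignored.
\<close>

record ('k, 'a) operad =
  space :: "nat \<Rightarrow> ('k, 'a) module"
  pcomp :: "nat \<Rightarrow> nat \<Rightarrow> nat \<Rightarrow> 'a \<Rightarrow> 'a \<Rightarrow> 'a"
  unity :: 'a

locale ns_operad = cring R
  for R :: "('k, 'r) ring_scheme" (structure) and P :: "('k, 'a, 'p) operad_scheme" +
  assumes space_module: "n \<ge> 1 \<Longrightarrow> Module.module R (space P n)"
    and pcomp_bilinear:
      "\<lbrakk>n \<ge> 1; m \<ge> 1; 1 \<le> i; i \<le> n\<rbrakk> \<Longrightarrow>
       bilinear_map R (space P n) (space P m) (space P (n + m - 1)) (pcomp P n m i)"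
    and unity_closed: "unity P \<in> carrier (space P 1)"
    and parallel_assoc:
      "\<lbrakk>n \<ge> 1; m \<ge> 1; l \<ge> 1; 1 \<le> i; i < j; j \<le> n;
        x \<in> carrier (space P n); y \<in> carrier (space P m); z \<in> carrier (space P l)\<rbrakk> \<Longrightarrow>
       pcomp P (n + m - 1) l (j + m - 1) (pcomp P n m i x y) z =
       pcomp P (n + l - 1) m i (pcomp P n l j x z) y"
    and sequential_assoc:
      "\<lbrakk>n \<ge> 1; m \<ge> 1; l \<ge> 1; 1 \<le> i; i \<le> n; 1 \<le> j; j \<le> m;
        x \<in> carrier (space P n); y \<in> carrier (space P m); z \<in> carrier (space P l)\<rbrakk> \<Longrightarrow>
       pcomp P (n + m - 1) l (i + j - 1) (pcomp P n m i x y) z =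
       pcomp P n (m + l - 1) i x (pcomp P m l j y z)"
    and right_unity:
      "\<lbrakk>n \<ge> 1; 1 \<le> i; i \<le> n; x \<in> carrier (space P n)\<rbrakk> \<Longrightarrow> pcomp P n 1 i x (unity P) = x"
    and left_unity:
      "\<lbrakk>n \<ge> 1; x \<in> carrier (space P n)\<rbrakk> \<Longrightarrow> pcomp P 1 n 1 (unity P) x = x"

locale ns_operad_morphism = dom: ns_operad R P + cod: ns_operad R Q
  for R :: "('k, 'r) ring_scheme"
    and P :: "('k, 'a, 'p) operad_scheme"
    and Q :: "('k, 'b, 'q) operad_scheme" +
  fixes f :: "nat \<Rightarrow> 'a \<Rightarrow> 'b"
  assumes hom_linear: "n \<ge> 1 \<Longrightarrow> linear_map R (space P n) (space Q n) (f n)"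
    and hom_pcomp:
      "\<lbrakk>n \<ge> 1; m \<ge> 1; 1 \<le> i; i \<le> n; x \<in> carrier (space P n); y \<in> carrier (space P m)\<rbrakk> \<Longrightarrow>
       f (n + m - 1) (pcomp P n m i x y) = pcomp Q n m i (f n x) (f m y)"
    and hom_unity: "f 1 (unity P) = unity Q"


section \<open>The operad of permutations\<close>

text \<open>
  A permutation \<open>\<sigma> \<in> S\<^sub>n\<close> is the list \<open>[\<sigma>\<^sub>1, \<dots>, \<sigma>\<^sub>n]\<close> of its values. List positions count from \<open>0\<close>,
  so \<open>\<sigma>\<^sub>i\<close> is \<open>\<sigma> ! (i - 1)\<close>.
\<close>

definition perms :: "nat \<Rightarrow> nat list set" where
  "perms n = permutations_of_set {1..n}"

definition perm_insert :: "nat \<Rightarrow> nat list \<Rightarrow> nat list \<Rightarrow> nat list" where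
  "perm_insert i \<sigma> \<tau> =
     (let m = length \<tau>;
          c = \<sigma> ! (i - 1);
          a = (\<lambda>v. if v < c then v else v + m - 1);
          b = (\<lambda>v. v + c - 1)
      in map a (take (i - 1) \<sigma>) @ map b \<tau> @ map a (drop i \<sigma>))"

definition perm_operad :: "('k, 'r) ring_scheme \<Rightarrow> ('k, nat list \<Rightarrow> 'k) operad" where
  "perm_operad R =
     \<lparr>space = (\<lambda>n. free_module R (perms n)),
      pcomp = (\<lambda>n m i. bilinear_extension R (perms n) (perms m) (perms (n + m - 1)) (perm_insert i)),
      unity = basis_elem R (perms 1) [1]\<rparr>"


section \<open>The operad of subsets\<close>

definition subsets :: "nat \<Rightarrow> nat set set" where
  "subsets n = Pow {1..n - 1}"

definition subset_insert :: "nat \<Rightarrow> nat \<Rightarrow> nat \<Rightarrow> nat set \<Rightarrow> nat set \<Rightarrow> nat set" where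
  "subset_insert n m i S T =
     (S \<inter> {1..i - 1}) \<union> (\<lambda>t. t + (i - 1)) ` T \<union> (\<lambda>s. s + (m - 1)) ` (S \<inter> {i..n - 1})"

definition subset_operad :: "('k, 'r) ring_scheme \<Rightarrow> ('k, nat set \<Rightarrow> 'k) operad" where
  "subset_operad R =
     \<lparr>space = (\<lambda>n. free_module R (subsets n)),
      pcomp = (\<lambda>n m i.
        bilinear_extension R (subsets n) (subsets m) (subsets (n + m - 1)) (subset_insert n m i)),
      unity = basis_elem R (subsets 1) {}\<rparr>"


section \<open>The descent map\<close>

definition Des :: "nat list \<Rightarrow> nat set" where
  "Des \<sigma> = {p \<in> {1..length \<sigma> - 1}. \<sigma> ! (p - 1) > \<sigma> ! p}"

definition descent_map :: "('k, 'r) ring_scheme \<Rightarrow> nat \<Rightarrow> (nat list \<Rightarrow> 'k) \<Rightarrow> (nat set \<Rightarrow> 'k)" where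
  "descent_map R n = linear_extension R (perms n) (subsets n) Des"


section \<open>The structure maps on basis elements\<close>

lemma finite_perms: "finite (perms n)"
  by (simp add: perms_def)

lemma finite_subsets: "finite (subsets n)"
  by (simp add: subsets_def)

lemma subset_insert_mem:
  assumes "n \<ge> 1" "m \<ge> 1" "1 \<le> i" "i \<le> n" "S \<in> subsets n" "T \<in> subsets m"
  shows "subset_insert n m i S T \<in> subsets (n + m - 1)"
  using assms by (fastforce simp: subset_insert_def subsets_def)

lemma Des_mem:
  assumes "\<sigma> \<in> perms n"
  shows "Des \<sigma> \<in> subsets n"
proof -
  have "length \<sigma> = n"
    using assms by (auto simp: perms_def permutations_of_set_def dest: distinct_card)
  then show ?thesis by (auto simp: Des_def subsets_def)
qed

lemma perm_insert_mem:
  assumes i: "1 \<le> i" "i \<le> n" and m: "m \<ge> 1" and s: "\<sigma> \<in> perms n" and t: "\<tau> \<in> perms m"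
  shows "perm_insert i \<sigma> \<tau> \<in> perms (n + m - 1)"
proof -
  have ls: "length \<sigma> = n" and lt: "length \<tau> = m"
    using s t by (auto simp: perms_def permutations_of_set_def dest: distinct_card)
  define c u w where "c = \<sigma> ! (i - 1)" and "u = take (i - 1) \<sigma>" and "w = drop i \<sigma>"
  have split: "\<sigma> = u @ c # w"
    using id_take_nth_drop[of "i - 1" \<sigma>] i ls by (simp add: c_def u_def w_def)
  have ds: "distinct (u @ c # w)" and ss: "set (u @ c # w) = {1..n}"
    using s by (simp_all add: perms_def permutations_of_set_def flip: split)
  have dt: "distinct \<tau>" and st: "set \<tau> = {1..m}"
    using t by (simp_all add: perms_def permutations_of_set_def)
  have c: "1 \<le> c" "c \<le> n" using ss by auto
  define a where "a = (\<lambda>v. if v < c then v else v + m - 1)"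
  define b where "b = (\<lambda>v. v + c - 1)"
  have eq: "perm_insert i \<sigma> \<tau> = map a u @ map b \<tau> @ map a w"
    by (simp add: perm_insert_def Let_def lt a_def b_def c_def u_def w_def)
  have rest: "set u \<union> set w = {1..n} - {c}"
    using ds ss by auto
  have ab: "a v \<noteq> b k" if "v \<in> set u \<union> set w" "k \<in> set \<tau>" for v k
    using that m by (auto simp: rest st a_def b_def)
  have inj: "inj_on a (set u \<union> set w)"
    using m by (auto simp: inj_on_def rest a_def split: if_splits)
  have ab_disj: "a ` (set u \<union> set w) \<inter> b ` set \<tau> = {}"
    using ab by (force simp only: image_iff Int_iff empty_iff)
  have "a ` set u \<inter> a ` set w = {}"
    using inj_on_image_Int[OF inj, of "set u" "set w"] ds by auto
  moreover have "inj_on b (set \<tau>)"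
    by (auto simp: inj_on_def b_def st)
  moreover have "inj_on a (set u)" "inj_on a (set w)"
    using inj by (auto intro: inj_on_subset)
  ultimately have "distinct (perm_insert i \<sigma> \<tau>)"
    using ds dt ab_disj by (simp add: eq distinct_map image_Un Int_Un_distrib Int_Un_distrib2 Int_commute)
  moreover have "set (perm_insert i \<sigma> \<tau>) \<subseteq> {1..n + m - 1}"
  proof -
    have "a ` (set u \<union> set w) \<subseteq> {1..n + m - 1}" unfolding rest using m c by (auto simp: a_def)
    moreover have "b ` set \<tau> \<subseteq> {1..n + m - 1}" using c by (auto simp: b_def st)
    ultimately show ?thesis by (auto simp: eq)
  qed
  moreover have "length (perm_insert i \<sigma> \<tau>) = n + m - 1"
    using i ls lt by (simp add: eq u_def w_def)
  ultimately show ?thesis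
    using card_subset_eq[of "{1..n + m - 1}" "set (perm_insert i \<sigma> \<tau>)"]
    by (simp add: perms_def permutations_of_set_def distinct_card)
qed

lemma free_module_module:
  assumes "cring R"
  shows "Module.module R (free_module R X)"
proof -
  interpret cring R by fact
  show ?thesis
  proof (rule Module.moduleI)
    show "abelian_group (free_module R X)"
    proof (rule abelian_groupI)
      fix x assume "x \<in> carrier (free_module R X)"
      then show "\<exists>y\<in>carrier (free_module R X). y \<oplus>\<^bsub>free_module R X\<^esub> x = \<zero>\<^bsub>free_module R X\<^esub>"
        by (intro bexI[of _ "\<lambda>s\<in>X. \<ominus>\<^bsub>R\<^esub> x s"])
           (auto simp: free_module_def PiE_iff l_neg intro!: restrict_ext)
    qed (auto simp: free_module_def PiE_iff a_ac extensional_def fun_eq_iff)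
  qed (auto simp: free_module_def PiE_iff extensional_def fun_eq_iff l_distr r_distr m_assoc
         intro: assms)
qed

lemma basis_elem_closed:
  assumes "cring R"
  shows "basis_elem R X s \<in> carrier (free_module R X)"
proof -
  interpret cring R by fact
  show ?thesis by (simp add: basis_elem_def free_module_def)
qed

lemma linear_extension_basis:
  assumes R: "cring R" and X: "finite X" "s \<in> X"
  shows "linear_extension R X Z \<phi> (basis_elem R X s) = basis_elem R Z (\<phi> s)"
proof -
  interpret Module.module R "free_module R Z" by (rule free_module_module[OF R])
  have "linear_extension R X Z \<phi> (basis_elem R X s) =
      (\<Oplus>\<^bsub>free_module R Z\<^esub>t\<in>X. if s = t then basis_elem R Z (\<phi> t) else \<zero>\<^bsub>free_module R Z\<^esub>)"
    unfolding linear_extension_def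
    by (rule M.finsum_cong') (auto simp: basis_elem_def[of R X] basis_elem_closed[OF R])
  also have "\<dots> = basis_elem R Z (\<phi> s)"
    using X by (intro M.finsum_singleton) (auto simp: basis_elem_closed[OF R])
  finally show ?thesis .
qed

lemma bilinear_extension_basis:
  assumes R: "cring R" and X: "finite X" "s \<in> X" and Y: "finite Y" "t \<in> Y"
  shows "bilinear_extension R X Y Z \<beta> (basis_elem R X s) (basis_elem R Y t) = basis_elem R Z (\<beta> s t)"
proof -
  interpret Module.module R "free_module R Z" by (rule free_module_module[OF R])
  have "bilinear_extension R X Y Z \<beta> (basis_elem R X s) (basis_elem R Y t) =
      (\<Oplus>\<^bsub>free_module R Z\<^esub>p\<in>X \<times> Y. if (s, t) = p then basis_elem R Z (\<beta> (fst p) (snd p))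
         else \<zero>\<^bsub>free_module R Z\<^esub>)"
    unfolding bilinear_extension_def
    by (rule M.finsum_cong')
       (auto simp: basis_elem_def[of R X] basis_elem_def[of R Y] basis_elem_closed[OF R])
  also have "\<dots> = basis_elem R Z (\<beta> (fst (s, t)) (snd (s, t)))"
    using X Y by (intro M.finsum_singleton) (auto simp: basis_elem_closed[OF R])
  finally show ?thesis by simp
qed

lemma pcomp_subset_operad_basis:
  assumes "cring R" "S \<in> subsets n" "T \<in> subsets m"
  shows "pcomp (subset_operad R) n m i (basis_elem R (subsets n) S) (basis_elem R (subsets m) T) =
         basis_elem R (subsets (n + m - 1)) (subset_insert n m i S T)"
  using assms by (simp add: subset_operad_def bilinear_extension_basis finite_subsets)

lemma pcomp_perm_operad_basis:
  assumes "cring R" "\<sigma> \<in> perms n" "\<tau> \<in> perms m"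
  shows "pcomp (perm_operad R) n m i (basis_elem R (perms n) \<sigma>) (basis_elem R (perms m) \<tau>) =
         basis_elem R (perms (n + m - 1)) (perm_insert i \<sigma> \<tau>)"
  using assms by (simp add: perm_operad_def bilinear_extension_basis finite_perms)

lemma descent_map_basis:
  assumes "cring R" "\<sigma> \<in> perms n"
  shows "descent_map R n (basis_elem R (perms n) \<sigma>) = basis_elem R (subsets n) (Des \<sigma>)"
  using assms by (simp add: descent_map_def linear_extension_basis finite_perms)

end

theory Submission
  imports Defs
begin

text \<open>
  All structure maps involved send basis elements to basis elements, so the statement is the image,
  under passage to free modules, of a statement about sets. A family of finite sets with partial
  compositions satisfying the operad axioms (\<open>set_operad\<close>) gives an operad of free modules:
  each associativity axiom equates two trilinear maps, and these are equal once they agree on bases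
  (\<open>ns_operad_linearization\<close>). In the same way a map of set operads extends to a
  morphism (\<open>ns_operad_morphism_linearization\<close>), and a surjection of bases extends to a
  surjective linear map (\<open>linear_extension_surj\<close>).

  What remains is combinatorial. A subset \<open>S\<close> of \<open>[n - 1]\<close> is a labelling, by membership, of the
  \<open>n - 1\<close> gaps between \<open>n\<close> consecutive slots, and inserting \<open>T\<close> at slot \<open>i\<close> replaces that slot by
  \<open>m\<close> slots with the \<open>m - 1\<close> inner gaps labelled by \<open>T\<close>. Read this way the operad
  axioms are evident; formally they follow by comparing membership of each gap. For permutations,
  insertion replaces the letter \<open>c = \<sigma>\<^sub>i\<close> by a block of consecutive values order isomorphic to \<open>\<tau>\<close>,
  and raises the letters above \<open>c\<close>. Every remaining letter therefore compares with each letter of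
  the block as it compared with \<open>c\<close>. Hence the descents at inner gaps of the block are those of \<open>\<tau>\<close> and all
  other descents are those of \<open>\<sigma>\<close>, which says that \<open>Des\<close> commutes with insertion
  (\<open>Des_perm_insert\<close>). Every subset is a descent set, since a permutation can be extended by a last
  letter that is the smallest or the largest, according to whether a descent is wanted there
  (\<open>Des_surj\<close>).
\<close>

section \<open>Linear maps on free modules\<close>

lemma linear_map_closed:
  "linear_map R M N f \<Longrightarrow> x \<in> carrier M \<Longrightarrow> f x \<in> carrier N"
  by (auto simp: linear_map_def)

lemma linear_map_cong:
  assumes "Module.module R M" "linear_map R M N f" "\<And>x. x \<in> carrier M \<Longrightarrow> f x = g x"
  shows "linear_map R M N g"
proof -
  interpret Module.module R M by fact
  show ?thesis
    using assms(2,3) by (simp add: linear_map_def Pi_iff)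
qed

lemma linear_map_comp:
  "linear_map R L M f \<Longrightarrow> linear_map R M N g \<Longrightarrow> linear_map R L N (\<lambda>x. g (f x))"
  by (auto simp: linear_map_def Pi_iff)

lemma linear_map_finsum:
  assumes M: "Module.module R M" and N: "Module.module R N" and f: "linear_map R M N f"
    and A: "finite A" and g: "g \<in> A \<rightarrow> carrier M"
  shows "f (\<Oplus>\<^bsub>M\<^esub>p\<in>A. g p) = (\<Oplus>\<^bsub>N\<^esub>p\<in>A. f (g p))"
proof -
  interpret M: Module.module R M by (rule M)
  interpret N: Module.module R N by (rule N)
  have "f (\<zero>\<^bsub>R\<^esub> \<odot>\<^bsub>M\<^esub> \<zero>\<^bsub>M\<^esub>) = \<zero>\<^bsub>R\<^esub> \<odot>\<^bsub>N\<^esub> f \<zero>\<^bsub>M\<^esub>"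
    using f M.R.zero_closed M.M.zero_closed unfolding linear_map_def by blast
  then have zero: "f \<zero>\<^bsub>M\<^esub> = \<zero>\<^bsub>N\<^esub>"
    using linear_map_closed[OF f] by simp
  show ?thesis
    using A g
  proof (induction A rule: finite_induct)
    case empty
    then show ?case by (simp add: zero)
  next
    case (insert p A)
    then have "(\<lambda>p. f (g p)) \<in> A \<rightarrow> carrier N" "f (g p) \<in> carrier N"
      using linear_map_closed[OF f] by auto
    with insert f show ?case
      by (simp add: linear_map_def)
  qed
qed

lemma linear_map_sum:
  assumes M: "Module.module R M" and N: "Module.module R N" and A: "finite A"
    and f: "\<And>p. p \<in> A \<Longrightarrow> linear_map R M N (f p)"
  shows "linear_map R M N (\<lambda>x. \<Oplus>\<^bsub>N\<^esub>p\<in>A. f p x)"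
proof -
  interpret M: Module.module R M by (rule M)
  interpret N: Module.module R N by (rule N)
  have cl: "f p x \<in> carrier N" if "p \<in> A" "x \<in> carrier M" for p x
    using linear_map_closed[OF f] that by auto
  have "(\<Oplus>\<^bsub>N\<^esub>p\<in>A. f p (x \<oplus>\<^bsub>M\<^esub> y)) = (\<Oplus>\<^bsub>N\<^esub>p\<in>A. f p x) \<oplus>\<^bsub>N\<^esub> (\<Oplus>\<^bsub>N\<^esub>p\<in>A. f p y)"
    if "x \<in> carrier M" "y \<in> carrier M" for x y
  proof -
    have "(\<Oplus>\<^bsub>N\<^esub>p\<in>A. f p (x \<oplus>\<^bsub>M\<^esub> y)) = (\<Oplus>\<^bsub>N\<^esub>p\<in>A. f p x \<oplus>\<^bsub>N\<^esub> f p y)"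
      using that f cl by (intro N.M.finsum_cong') (auto simp: linear_map_def)
    then show ?thesis
      using that cl by (simp add: N.M.finsum_addf Pi_iff)
  qed
  moreover have "(\<Oplus>\<^bsub>N\<^esub>p\<in>A. f p (r \<odot>\<^bsub>M\<^esub> x)) = r \<odot>\<^bsub>N\<^esub> (\<Oplus>\<^bsub>N\<^esub>p\<in>A. f p x)"
    if "r \<in> carrier R" "x \<in> carrier M" for r x
  proof -
    have "(\<Oplus>\<^bsub>N\<^esub>p\<in>A. f p (r \<odot>\<^bsub>M\<^esub> x)) = (\<Oplus>\<^bsub>N\<^esub>p\<in>A. r \<odot>\<^bsub>N\<^esub> f p x)"
      using that f cl by (intro N.M.finsum_cong') (auto simp: linear_map_def)
    then show ?thesis
      using that cl A by (simp add: N.finsum_smult_ldistr Pi_iff)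
  qed
  ultimately show ?thesis
    using cl by (auto simp: linear_map_def)
qed

lemma finsum_free_module_apply:
  assumes R: "cring R" and A: "finite A" and g: "g \<in> A \<rightarrow> carrier (free_module R Z)" and t: "t \<in> Z"
  shows "(\<Oplus>\<^bsub>free_module R Z\<^esub>p\<in>A. g p) t = (\<Oplus>\<^bsub>R\<^esub>p\<in>A. g p t)"
proof -
  interpret Module.module R "free_module R Z" by (rule free_module_module[OF R])
  show ?thesis
    using A g
  proof (induction A rule: finite_induct)
    case empty
    have "\<zero>\<^bsub>free_module R Z\<^esub> t = \<zero>\<^bsub>R\<^esub>"
      using t by (simp add: free_module_def)
    then show ?case by simp
  next
    case (insert p A)
    then have "(\<lambda>p. g p t) \<in> A \<rightarrow> carrier R" "g p t \<in> carrier R"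
      using t by (auto simp: free_module_def PiE_iff Pi_iff)
    moreover have "(x \<oplus>\<^bsub>free_module R Z\<^esub> y) t = x t \<oplus>\<^bsub>R\<^esub> y t" for x y
      using t by (simp add: free_module_def)
    ultimately show ?case
      using insert by simp
  qed
qed

lemma free_module_expansion:
  assumes R: "cring R" and X: "finite X" and x: "x \<in> carrier (free_module R X)"
  shows "x = (\<Oplus>\<^bsub>free_module R X\<^esub>s\<in>X. x s \<odot>\<^bsub>free_module R X\<^esub> basis_elem R X s)" (is "x = ?y")
proof -
  interpret Module.module R "free_module R X" by (rule free_module_module[OF R])
  have xs: "x s \<in> carrier R" if "s \<in> X" for s
    using x that by (auto simp: free_module_def)
  then have cl: "(\<lambda>s. x s \<odot>\<^bsub>free_module R X\<^esub> basis_elem R X s) \<in> X \<rightarrow> carrier (free_module R X)"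
    by (simp add: basis_elem_closed[OF R])
  show ?thesis
  proof (rule PiE_ext)
    show "x \<in> X \<rightarrow>\<^sub>E carrier R" "?y \<in> X \<rightarrow>\<^sub>E carrier R"
      using x M.finsum_closed[OF cl] by (simp_all add: free_module_def)
    fix t assume t: "t \<in> X"
    have "?y t = (\<Oplus>\<^bsub>R\<^esub>s\<in>X. (x s \<odot>\<^bsub>free_module R X\<^esub> basis_elem R X s) t)"
      by (rule finsum_free_module_apply[OF R X cl t])
    also have "\<dots> = (\<Oplus>\<^bsub>R\<^esub>s\<in>X. if t = s then x s else \<zero>\<^bsub>R\<^esub>)"
      using xs t by (intro R.finsum_cong') (auto simp: free_module_def basis_elem_def)
    also have "\<dots> = x t"
      using X t xs by (intro R.finsum_singleton) auto
    finally show "x t = ?y t" by simp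
  qed
qed

text \<open>
  Linear maps commute with the expansion of \<open>x\<close> in the basis; finiteness of \<open>X\<close> makes that
  expansion a sum in the module.
\<close>

lemma linear_map_free_module_eqI:
  assumes R: "cring R" and X: "finite X" and M: "Module.module R M"
    and f: "linear_map R (free_module R X) M f" and g: "linear_map R (free_module R X) M g"
    and eq: "\<And>s. s \<in> X \<Longrightarrow> f (basis_elem R X s) = g (basis_elem R X s)"
    and x: "x \<in> carrier (free_module R X)"
  shows "f x = g x"
proof -
  interpret F: Module.module R "free_module R X" by (rule free_module_module[OF R])
  interpret M: Module.module R M by (rule M)
  let ?g = "\<lambda>s. x s \<odot>\<^bsub>free_module R X\<^esub> basis_elem R X s"
  have xs: "x s \<in> carrier R" if "s \<in> X" for s
    using x that by (auto simp: free_module_def)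
  then have cl: "?g \<in> X \<rightarrow> carrier (free_module R X)"
    by (simp add: basis_elem_closed[OF R])
  have "f (?g s) = g (?g s)" if "s \<in> X" for s
    using f g xs[OF that] eq[OF that] by (simp add: linear_map_def basis_elem_closed[OF R])
  then have "(\<Oplus>\<^bsub>M\<^esub>s\<in>X. f (?g s)) = (\<Oplus>\<^bsub>M\<^esub>s\<in>X. g (?g s))"
    using linear_map_closed[OF g] cl by (intro M.M.finsum_cong') auto
  then show ?thesis
    using linear_map_finsum[OF F.module_axioms M f X cl] linear_map_finsum[OF F.module_axioms M g X cl]
      free_module_expansion[OF R X x] by simp
qed

text \<open>
  With one argument fixed, a bilinear extension is a sum of maps of this form.
\<close>

lemma linear_map_coordinate_smult:
  assumes R: "cring R" and M: "Module.module R M" and s: "s \<in> X"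
    and c: "c \<in> carrier R" and v: "v \<in> carrier M"
  shows "linear_map R (free_module R X) M (\<lambda>x. (x s \<otimes>\<^bsub>R\<^esub> c) \<odot>\<^bsub>M\<^esub> v)"
proof -
  interpret M: Module.module R M by (rule M)
  show ?thesis
    unfolding linear_map_def
    using s c v
    by (auto simp: free_module_def PiE_iff M.smult_l_distr M.l_distr M.smult_assoc1 M.m_assoc)
qed

lemma linear_map_linear_extension:
  assumes R: "cring R" and X: "finite X"
  shows "linear_map R (free_module R X) (free_module R Z) (linear_extension R X Z \<phi>)"
proof -
  interpret F: Module.module R "free_module R Z" by (rule free_module_module[OF R])
  have "linear_map R (free_module R X) (free_module R Z)
      (\<lambda>x. x s \<odot>\<^bsub>free_module R Z\<^esub> basis_elem R Z (\<phi> s))" if "s \<in> X" for s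
    unfolding linear_map_def using that basis_elem_closed[OF R, of Z "\<phi> s"]
    by (auto simp: free_module_def[of R X] PiE_iff F.smult_l_distr F.smult_assoc1)
  then have "linear_map R (free_module R X) (free_module R Z)
      (\<lambda>x. \<Oplus>\<^bsub>free_module R Z\<^esub>s\<in>X. x s \<odot>\<^bsub>free_module R Z\<^esub> basis_elem R Z (\<phi> s))"
    by (intro linear_map_sum free_module_module R X)
  then show ?thesis by (simp add: linear_extension_def[abs_def])
qed

lemma bilinear_map_bilinear_extension:
  assumes R: "cring R" and X: "finite X" and Y: "finite Y"
  shows "bilinear_map R (free_module R X) (free_module R Y) (free_module R Z)
    (bilinear_extension R X Y Z \<beta>)"
  unfolding bilinear_map_def bilinear_extension_def[abs_def]
proof (intro conjI ballI linear_map_sum free_module_module R finite_cartesian_product X Y)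
  interpret cring R by fact
  fix x p assume "x \<in> carrier (free_module R X)" "p \<in> X \<times> Y"
  then have *: "x (fst p) \<in> carrier R" "snd p \<in> Y"
    by (auto simp: free_module_def PiE_iff)
  have swapped: "linear_map R (free_module R Y) (free_module R Z)
      (\<lambda>y. (y (snd p) \<otimes>\<^bsub>R\<^esub> x (fst p)) \<odot>\<^bsub>free_module R Z\<^esub> basis_elem R Z (\<beta> (fst p) (snd p)))"
    using * by (intro linear_map_coordinate_smult free_module_module R basis_elem_closed)
  have "y (snd p) \<otimes>\<^bsub>R\<^esub> x (fst p) = x (fst p) \<otimes>\<^bsub>R\<^esub> y (snd p)"
    if "y \<in> carrier (free_module R Y)" for y
    using that * by (auto simp: free_module_def PiE_iff m_comm)
  then show "linear_map R (free_module R Y) (free_module R Z)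
      (\<lambda>y. (x (fst p) \<otimes>\<^bsub>R\<^esub> y (snd p)) \<odot>\<^bsub>free_module R Z\<^esub> basis_elem R Z (\<beta> (fst p) (snd p)))"
    by (intro linear_map_cong[OF free_module_module[OF R] swapped]) simp
next
  fix y p assume "y \<in> carrier (free_module R Y)" "p \<in> X \<times> Y"
  then have "y (snd p) \<in> carrier R" "fst p \<in> X"
    by (auto simp: free_module_def PiE_iff)
  then show "linear_map R (free_module R X) (free_module R Z)
      (\<lambda>x. (x (fst p) \<otimes>\<^bsub>R\<^esub> y (snd p)) \<odot>\<^bsub>free_module R Z\<^esub> basis_elem R Z (\<beta> (fst p) (snd p)))"
    by (intro linear_map_coordinate_smult free_module_module R basis_elem_closed)
qed

lemma linear_map_bilinear_extension_left:
  assumes "cring R" "finite X" "finite Y" "y \<in> carrier (free_module R Y)"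
  shows "linear_map R (free_module R X) (free_module R Z) (\<lambda>x. bilinear_extension R X Y Z \<beta> x y)"
  using bilinear_map_bilinear_extension assms unfolding bilinear_map_def by blast

lemma linear_map_bilinear_extension_right:
  assumes "cring R" "finite X" "finite Y" "x \<in> carrier (free_module R X)"
  shows "linear_map R (free_module R Y) (free_module R Z) (bilinear_extension R X Y Z \<beta> x)"
  using bilinear_map_bilinear_extension assms unfolding bilinear_map_def by blast

lemma bilinear_extension_closed:
  assumes "cring R" "finite X" "finite Y"
    "x \<in> carrier (free_module R X)" "y \<in> carrier (free_module R Y)"
  shows "bilinear_extension R X Y Z \<beta> x y \<in> carrier (free_module R Z)"
  using linear_map_closed[OF linear_map_bilinear_extension_right] assms by blast

text \<open>
  A section \<open>\<psi>\<close> of \<open>\<phi>\<close> over \<open>Z\<close> extends linearly to a section of the linear extension of \<open>\<phi>\<close>, because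
  the composite fixes the basis.
\<close>

lemma linear_extension_surj:
  assumes R: "cring R" and X: "finite X" and Z: "finite Z" and onto: "Z \<subseteq> \<phi> ` X"
  shows "linear_extension R X Z \<phi> ` carrier (free_module R X) = carrier (free_module R Z)"
proof
  have lin: "linear_map R (free_module R X) (free_module R Z) (linear_extension R X Z \<phi>)"
    by (rule linear_map_linear_extension[OF R X])
  show "linear_extension R X Z \<phi> ` carrier (free_module R X) \<subseteq> carrier (free_module R Z)"
    using linear_map_closed[OF lin] by blast
  obtain \<psi> where \<psi>: "\<psi> z \<in> X" "\<phi> (\<psi> z) = z" if "z \<in> Z" for z
    using onto by (metis image_iff subset_iff)
  have lin': "linear_map R (free_module R Z) (free_module R X) (linear_extension R Z X \<psi>)"
    by (rule linear_map_linear_extension[OF R Z])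
  show "carrier (free_module R Z) \<subseteq> linear_extension R X Z \<phi> ` carrier (free_module R X)"
  proof
    fix z assume z: "z \<in> carrier (free_module R Z)"
    have "linear_extension R X Z \<phi> (linear_extension R Z X \<psi> z) = z"
    proof (rule linear_map_free_module_eqI[OF R Z free_module_module[OF R]
          linear_map_comp[OF lin' lin] _ _ z])
      show "linear_map R (free_module R Z) (free_module R Z) (\<lambda>z. z)"
        by (simp add: linear_map_def)
    qed (simp add: linear_extension_basis R X Z \<psi>)
    with linear_map_closed[OF lin' z]
    show "z \<in> linear_extension R X Z \<phi> ` carrier (free_module R X)"
      by (metis imageI)
  qed
qed


section \<open>Linearized set operads\<close>

text \<open>
  This is the set-level counterpart of \<^locale>\<open>ns_operad\<close>. The sets are finite because a free module is
  represented here by all families of coordinates, which for an infinite basis would be too many.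
\<close>

locale set_operad =
  fixes X :: "nat \<Rightarrow> 'b set" and \<beta> :: "nat \<Rightarrow> nat \<Rightarrow> nat \<Rightarrow> 'b \<Rightarrow> 'b \<Rightarrow> 'b" and e :: 'b
  assumes finite: "finite (X n)"
    and closed: "\<lbrakk>n \<ge> 1; m \<ge> 1; 1 \<le> i; i \<le> n; s \<in> X n; t \<in> X m\<rbrakk> \<Longrightarrow> \<beta> n m i s t \<in> X (n + m - 1)"
    and unit_closed: "e \<in> X 1"
    and parallel:
      "\<lbrakk>n \<ge> 1; m \<ge> 1; l \<ge> 1; 1 \<le> i; i < j; j \<le> n; s \<in> X n; t \<in> X m; u \<in> X l\<rbrakk> \<Longrightarrow>
       \<beta> (n + m - 1) l (j + m - 1) (\<beta> n m i s t) u = \<beta> (n + l - 1) m i (\<beta> n l j s u) t"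
    and sequential:
      "\<lbrakk>n \<ge> 1; m \<ge> 1; l \<ge> 1; 1 \<le> i; i \<le> n; 1 \<le> j; j \<le> m; s \<in> X n; t \<in> X m; u \<in> X l\<rbrakk> \<Longrightarrow>
       \<beta> (n + m - 1) l (i + j - 1) (\<beta> n m i s t) u = \<beta> n (m + l - 1) i s (\<beta> m l j t u)"
    and right_unit: "\<lbrakk>n \<ge> 1; 1 \<le> i; i \<le> n; s \<in> X n\<rbrakk> \<Longrightarrow> \<beta> n 1 i s e = s"
    and left_unit: "\<lbrakk>n \<ge> 1; s \<in> X n\<rbrakk> \<Longrightarrow> \<beta> 1 n 1 e s = s"

definition linearization ::
  "('k, 'r) ring_scheme \<Rightarrow> (nat \<Rightarrow> 'b set) \<Rightarrow> (nat \<Rightarrow> nat \<Rightarrow> nat \<Rightarrow> 'b \<Rightarrow> 'b \<Rightarrow> 'b) \<Rightarrow> 'b \<Rightarrow>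
   ('k, 'b \<Rightarrow> 'k) operad"
where
  "linearization R X \<beta> e =
     \<lparr>space = (\<lambda>n. free_module R (X n)),
      pcomp = (\<lambda>n m i. bilinear_extension R (X n) (X m) (X (n + m - 1)) (\<beta> n m i)),
      unity = basis_elem R (X 1) e\<rparr>"

text \<open>
  Both associativity axioms are identities of this kind. Basis elements are replaced by
  arbitrary elements one argument at a time.
\<close>

lemma trilinear_free_module_eqI:
  assumes R: "cring R" and fin: "finite X" "finite Y" "finite Z" and M: "Module.module R M"
    and f1: "\<And>y z. \<lbrakk>y \<in> carrier (free_module R Y); z \<in> carrier (free_module R Z)\<rbrakk> \<Longrightarrow>
        linear_map R (free_module R X) M (\<lambda>x. f x y z)"
    and f2: "\<And>x z. \<lbrakk>x \<in> carrier (free_module R X); z \<in> carrier (free_module R Z)\<rbrakk> \<Longrightarrow>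
        linear_map R (free_module R Y) M (\<lambda>y. f x y z)"
    and f3: "\<And>x y. \<lbrakk>x \<in> carrier (free_module R X); y \<in> carrier (free_module R Y)\<rbrakk> \<Longrightarrow>
        linear_map R (free_module R Z) M (\<lambda>z. f x y z)"
    and g1: "\<And>y z. \<lbrakk>y \<in> carrier (free_module R Y); z \<in> carrier (free_module R Z)\<rbrakk> \<Longrightarrow>
        linear_map R (free_module R X) M (\<lambda>x. g x y z)"
    and g2: "\<And>x z. \<lbrakk>x \<in> carrier (free_module R X); z \<in> carrier (free_module R Z)\<rbrakk> \<Longrightarrow>
        linear_map R (free_module R Y) M (\<lambda>y. g x y z)"
    and g3: "\<And>x y. \<lbrakk>x \<in> carrier (free_module R X); y \<in> carrier (free_module R Y)\<rbrakk> \<Longrightarrow>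
        linear_map R (free_module R Z) M (\<lambda>z. g x y z)"
    and eq: "\<And>s t u. \<lbrakk>s \<in> X; t \<in> Y; u \<in> Z\<rbrakk> \<Longrightarrow>
        f (basis_elem R X s) (basis_elem R Y t) (basis_elem R Z u) =
        g (basis_elem R X s) (basis_elem R Y t) (basis_elem R Z u)"
    and x: "x \<in> carrier (free_module R X)" and y: "y \<in> carrier (free_module R Y)"
    and z: "z \<in> carrier (free_module R Z)"
  shows "f x y z = g x y z"
proof -
  note b = basis_elem_closed[OF R]
  note ext = linear_map_free_module_eqI[OF R _ M]
  have "f (basis_elem R X s) (basis_elem R Y t) z = g (basis_elem R X s) (basis_elem R Y t) z"
    if "s \<in> X" "t \<in> Y" for s t
    by (rule ext[OF fin(3) f3[OF b b] g3[OF b b] eq[OF that] z])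
  then have "f (basis_elem R X s) y z = g (basis_elem R X s) y z" if "s \<in> X" for s
    using that by (intro ext[OF fin(2) f2[OF b z] g2[OF b z] _ y])
  then show ?thesis
    by (rule ext[OF fin(1) f1[OF y z] g1[OF y z] _ x])
qed

context set_operad
begin

lemma ns_operad_linearization:
  fixes R :: "('k, 'r) ring_scheme"
  assumes R: "cring R"
  shows "ns_operad R (linearization R X \<beta> e)"
proof -
  note lin = linear_map_bilinear_extension_left[OF R finite finite]
    linear_map_bilinear_extension_right[OF R finite finite]
  note cl = bilinear_extension_closed[OF R finite finite]
  note bas = bilinear_extension_basis[OF R finite _ finite]
  note fm = free_module_module[OF R]
  show ?thesis
  proof (intro ns_operad.intro R ns_operad_axioms.intro; unfold linearization_def; simp only: operad.simps)
    fix n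
    show "Module.module R (free_module R (X n))" by (rule fm)
  next
    fix n m i
    show "bilinear_map R (free_module R (X n)) (free_module R (X m)) (free_module R (X (n + m - 1)))
        (bilinear_extension R (X n) (X m) (X (n + m - 1)) (\<beta> n m i))"
      by (rule bilinear_map_bilinear_extension[OF R finite finite])
  next
    show "basis_elem R (X 1) e \<in> carrier (free_module R (X 1))"
      by (rule basis_elem_closed[OF R])
  next
    fix n m l i j :: nat and x y z :: "'b \<Rightarrow> 'k"
    assume *: "1 \<le> n" "1 \<le> m" "1 \<le> l" "1 \<le> i" "i < j" "j \<le> n"
      and x: "x \<in> carrier (free_module R (X n))" and y: "y \<in> carrier (free_module R (X m))"
      and z: "z \<in> carrier (free_module R (X l))"
    have arity: "n + l - 1 + m - 1 = n + m - 1 + l - 1" using * by simp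
    show "bilinear_extension R (X (n + m - 1)) (X l) (X (n + m - 1 + l - 1)) (\<beta> (n + m - 1) l (j + m - 1))
          (bilinear_extension R (X n) (X m) (X (n + m - 1)) (\<beta> n m i) x y) z =
        bilinear_extension R (X (n + l - 1)) (X m) (X (n + l - 1 + m - 1)) (\<beta> (n + l - 1) m i)
          (bilinear_extension R (X n) (X l) (X (n + l - 1)) (\<beta> n l j) x z) y"
      unfolding arity
      \<comment> \<open>The six linearity conditions: a composition that is linear in the varying argument, alone or
        followed by a linear one, according to how deep that argument sits.\<close>
      apply (rule trilinear_free_module_eqI[OF R finite finite finite fm _ _ _ _ _ _ _ x y z])
            apply (rule linear_map_comp[OF lin(1) lin(1)]; assumption)
           apply (rule linear_map_comp[OF lin(2) lin(1)]; assumption)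
          apply (rule lin(2)[OF cl]; assumption)
         apply (rule linear_map_comp[OF lin(1) lin(1)]; assumption)
        apply (rule lin(2)[OF cl]; assumption)
       apply (rule linear_map_comp[OF lin(2) lin(1)]; assumption)
      using * parallel closed by (simp add: bas)
  next
    fix n m l i j :: nat and x y z :: "'b \<Rightarrow> 'k"
    assume *: "1 \<le> n" "1 \<le> m" "1 \<le> l" "1 \<le> i" "i \<le> n" "1 \<le> j" "j \<le> m"
      and x: "x \<in> carrier (free_module R (X n))" and y: "y \<in> carrier (free_module R (X m))"
      and z: "z \<in> carrier (free_module R (X l))"
    have arity: "n + (m + l - 1) - 1 = n + m - 1 + l - 1" using * by simp
    show "bilinear_extension R (X (n + m - 1)) (X l) (X (n + m - 1 + l - 1)) (\<beta> (n + m - 1) l (i + j - 1))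
          (bilinear_extension R (X n) (X m) (X (n + m - 1)) (\<beta> n m i) x y) z =
        bilinear_extension R (X n) (X (m + l - 1)) (X (n + (m + l - 1) - 1)) (\<beta> n (m + l - 1) i) x
          (bilinear_extension R (X m) (X l) (X (m + l - 1)) (\<beta> m l j) y z)"
      unfolding arity
      apply (rule trilinear_free_module_eqI[OF R finite finite finite fm _ _ _ _ _ _ _ x y z])
            apply (rule linear_map_comp[OF lin(1) lin(1)]; assumption)
           apply (rule linear_map_comp[OF lin(2) lin(1)]; assumption)
          apply (rule lin(2)[OF cl]; assumption)
         apply (rule lin(1)[OF cl]; assumption)
        apply (rule linear_map_comp[OF lin(1) lin(2)]; assumption)
       apply (rule linear_map_comp[OF lin(2) lin(2)]; assumption)
      using * sequential closed by (simp add: bas)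
  next
    fix n i :: nat and x :: "'b \<Rightarrow> 'k"
    assume *: "1 \<le> n" "1 \<le> i" "i \<le> n" and x: "x \<in> carrier (free_module R (X n))"
    have "n + 1 - 1 = n" by simp
    show "bilinear_extension R (X n) (X 1) (X (n + 1 - 1)) (\<beta> n 1 i) x (basis_elem R (X 1) e) = x"
      unfolding \<open>n + 1 - 1 = n\<close>
      using * right_unit unit_closed
      by (intro linear_map_free_module_eqI[OF R finite fm lin(1)[OF basis_elem_closed[OF R]] _ _ x])
         (simp_all add: linear_map_def bas)
  next
    fix n :: nat and x :: "'b \<Rightarrow> 'k"
    assume *: "1 \<le> n" and x: "x \<in> carrier (free_module R (X n))"
    have "1 + n - 1 = n" by simp
    show "bilinear_extension R (X 1) (X n) (X (1 + n - 1)) (\<beta> 1 n 1) (basis_elem R (X 1) e) x = x"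
      unfolding \<open>1 + n - 1 = n\<close>
      using * left_unit unit_closed
      by (intro linear_map_free_module_eqI[OF R finite fm lin(2)[OF basis_elem_closed[OF R]] _ _ x])
         (simp_all add: linear_map_def bas)
  qed
qed

end

lemma ns_operad_morphism_linearization:
  fixes R :: "('k, 'r) ring_scheme"
  assumes R: "cring R" and X: "set_operad X \<beta> e" and Y: "set_operad Y \<gamma> d"
    and mem: "\<And>n s. \<lbrakk>n \<ge> 1; s \<in> X n\<rbrakk> \<Longrightarrow> \<phi> n s \<in> Y n"
    and hom: "\<And>n m i s t. \<lbrakk>n \<ge> 1; m \<ge> 1; 1 \<le> i; i \<le> n; s \<in> X n; t \<in> X m\<rbrakk> \<Longrightarrow>
      \<phi> (n + m - 1) (\<beta> n m i s t) = \<gamma> n m i (\<phi> n s) (\<phi> m t)"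
    and unit: "\<phi> 1 e = d"
  shows "ns_operad_morphism R (linearization R X \<beta> e) (linearization R Y \<gamma> d)
    (\<lambda>n. linear_extension R (X n) (Y n) (\<phi> n))"
proof -
  interpret X: set_operad X \<beta> e by (rule X)
  interpret Y: set_operad Y \<gamma> d by (rule Y)
  note lin = linear_map_linear_extension[OF R X.finite]
  note fm = free_module_module[OF R]
  show ?thesis
  proof (intro ns_operad_morphism.intro ns_operad_morphism_axioms.intro
      X.ns_operad_linearization Y.ns_operad_linearization R; unfold linearization_def; simp only: operad.simps)
    fix n
    show "linear_map R (free_module R (X n)) (free_module R (Y n)) (linear_extension R (X n) (Y n) (\<phi> n))"
      by (rule lin)
  next
    fix n m i :: nat and x y :: "'a \<Rightarrow> 'k"
    assume *: "1 \<le> n" "1 \<le> m" "1 \<le> i" "i \<le> n"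
      and x: "x \<in> carrier (free_module R (X n))" and y: "y \<in> carrier (free_module R (X m))"
    let ?\<phi> = "\<lambda>n. linear_extension R (X n) (Y n) (\<phi> n)"
    let ?b = "bilinear_extension R (X n) (X m) (X (n + m - 1)) (\<beta> n m i)"
    let ?c = "bilinear_extension R (Y n) (Y m) (Y (n + m - 1)) (\<gamma> n m i)"
    note left = linear_map_bilinear_extension_left[OF R] and right = linear_map_bilinear_extension_right[OF R]
    note b = basis_elem_closed[OF R]
    note phi = linear_map_closed[OF lin]
    have "?\<phi> (n + m - 1) (?b (basis_elem R (X n) s) (basis_elem R (X m) t)) =
        ?c (?\<phi> n (basis_elem R (X n) s)) (?\<phi> m (basis_elem R (X m) t))" if "s \<in> X n" "t \<in> X m" for s t
      using * that hom mem X.closed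
      by (simp add: bilinear_extension_basis[OF R] linear_extension_basis[OF R] X.finite Y.finite)
    then have "?\<phi> (n + m - 1) (?b (basis_elem R (X n) s) y) = ?c (?\<phi> n (basis_elem R (X n) s)) (?\<phi> m y)"
      if "s \<in> X n" for s
      using that
      by (intro linear_map_free_module_eqI[OF R X.finite fm
            linear_map_comp[OF right[OF X.finite X.finite b] lin]
            linear_map_comp[OF lin right[OF Y.finite Y.finite phi[OF b]]] _ y])
    then show "?\<phi> (n + m - 1) (?b x y) = ?c (?\<phi> n x) (?\<phi> m y)"
      by (intro linear_map_free_module_eqI[OF R X.finite fm
            linear_map_comp[OF left[OF X.finite X.finite y] lin]
            linear_map_comp[OF lin left[OF Y.finite Y.finite phi[OF y]]] _ x])
  next
    show "linear_extension R (X 1) (Y 1) (\<phi> 1) (basis_elem R (X 1) e) = basis_elem R (Y 1) d"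
      by (simp only: linear_extension_basis[OF R X.finite X.unit_closed] unit)
  qed
qed


section \<open>Insertion of subsets\<close>

lemma mem_subset_insert_iff:
  assumes "m \<ge> 1" "1 \<le> i" "S \<in> subsets n" "T \<in> subsets m"
  shows "p \<in> subset_insert n m i S T \<longleftrightarrow>
    (if p < i then p \<in> S else if p < i + m - 1 then p - (i - 1) \<in> T else p - (m - 1) \<in> S)"
proof -
  have S: "s \<in> S \<Longrightarrow> 1 \<le> s \<and> s \<le> n - 1" for s using assms by (auto simp: subsets_def)
  have T: "t \<in> T \<Longrightarrow> 1 \<le> t \<and> t \<le> m - 1" for t using assms by (auto simp: subsets_def)
  have "p \<in> (\<lambda>t. t + (i - 1)) ` T \<longleftrightarrow> i - 1 \<le> p \<and> p - (i - 1) \<in> T"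
    by (force simp: image_iff)
  moreover have "p \<in> (\<lambda>s. s + (m - 1)) ` (S \<inter> {i..n - 1}) \<longleftrightarrow>
      m - 1 \<le> p \<and> p - (m - 1) \<in> S \<and> i \<le> p - (m - 1)"
    using S by (force simp: image_iff)
  moreover have "p \<in> S \<inter> {1..i - 1} \<longleftrightarrow> p \<in> S \<and> p < i"
    using S assms by force
  ultimately show ?thesis
    unfolding subset_insert_def Un_iff using assms(1,2) S[of "p - (m - 1)"] T[of "p - (i - 1)"]
    by (cases "p < i"; cases "p < i + m - 1") auto
qed

text \<open>
  The same criterion in terms of the predecessors of \<open>m\<close> and \<open>i\<close>, which removes the truncated
  subtractions of \<open>1\<close>.
\<close>

lemma mem_subset_insert_Suc_iff:
  assumes "S \<in> subsets n" "T \<in> subsets (Suc m)"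
  shows "p \<in> subset_insert n (Suc m) (Suc i) S T \<longleftrightarrow>
    (if p \<le> i then p \<in> S else if p \<le> i + m then p - i \<in> T else p - m \<in> S)"
  using mem_subset_insert_iff[of "Suc m" "Suc i" S n T p] assms by (simp add: less_Suc_eq_le)

lemma set_operad_subsets: "set_operad subsets subset_insert {}"
proof
  fix n m l i j :: nat and S T U
  assume *: "1 \<le> n" "1 \<le> m" "1 \<le> l" "1 \<le> i" "i < j" "j \<le> n"
    and mem: "S \<in> subsets n" "T \<in> subsets m" "U \<in> subsets l"
  obtain m' l' i' j' where pred: "m = Suc m'" "l = Suc l'" "i = Suc i'" "j = Suc j'"
    using * by (metis Suc_le_D One_nat_def less_imp_le_nat order_trans)
  note S = mem(1) and T = mem(2)[unfolded pred] and U = mem(3)[unfolded pred]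
  have ST: "subset_insert n (Suc m') (Suc i') S T \<in> subsets (n + m')"
    using subset_insert_mem[of n m i S T] * mem by (simp add: pred)
  have SU: "subset_insert n (Suc l') (Suc j') S U \<in> subsets (n + l')"
    using subset_insert_mem[of n l j S U] * mem by (simp add: pred)
  have order: "i' < j'" using * by (simp add: pred)
  note iff = mem_subset_insert_Suc_iff[OF S T] mem_subset_insert_Suc_iff[OF S U]
    mem_subset_insert_Suc_iff[OF ST U] mem_subset_insert_Suc_iff[OF SU T]
  show "subset_insert (n + m - 1) l (j + m - 1) (subset_insert n m i S T) U =
    subset_insert (n + l - 1) m i (subset_insert n l j S U) T"
  proof (rule Set.set_eqI)
    fix p
    have shift: "p - (l' + m') = p - (m' + l')" "p - (j' + m') = p - (m' + j')"
      by (simp_all add: add.commute)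
    \<comment> \<open>The gap \<open>p\<close> lies in one of five runs, read from left to right: \<open>S\<close>, \<open>T\<close>, \<open>S\<close>, \<open>U\<close>, \<open>S\<close>.\<close>
    consider "p \<le> i'" | "i' < p" "p \<le> i' + m'" | "i' + m' < p" "p \<le> j' + m'"
      | "j' + m' < p" "p \<le> j' + m' + l'" | "j' + m' + l' < p"
      by linarith
    then show "p \<in> subset_insert (n + m - 1) l (j + m - 1) (subset_insert n m i S T) U \<longleftrightarrow>
      p \<in> subset_insert (n + l - 1) m i (subset_insert n l j S U) T"
      by cases (use order in \<open>simp_all add: pred iff shift le_diff_conv\<close>)
  qed
next
  fix n m l i j :: nat and S T U
  assume *: "1 \<le> n" "1 \<le> m" "1 \<le> l" "1 \<le> i" "i \<le> n" "1 \<le> j" "j \<le> m"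
    and mem: "S \<in> subsets n" "T \<in> subsets m" "U \<in> subsets l"
  obtain m' l' i' j' where pred: "m = Suc m'" "l = Suc l'" "i = Suc i'" "j = Suc j'"
    using * by (metis Suc_le_D One_nat_def)
  note S = mem(1) and T = mem(2)[unfolded pred] and U = mem(3)[unfolded pred]
  have ST: "subset_insert n (Suc m') (Suc i') S T \<in> subsets (n + m')"
    using subset_insert_mem[of n m i S T] * mem by (simp add: pred)
  have TU: "subset_insert (Suc m') (Suc l') (Suc j') T U \<in> subsets (Suc (m' + l'))"
    using subset_insert_mem[of m l j T U] * mem by (simp add: pred)
  have order: "j' \<le> m'" using * by (simp add: pred)
  note iff = mem_subset_insert_Suc_iff[OF S T] mem_subset_insert_Suc_iff[OF T U]
    mem_subset_insert_Suc_iff[OF ST U] mem_subset_insert_Suc_iff[OF S TU]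
  show "subset_insert (n + m - 1) l (i + j - 1) (subset_insert n m i S T) U =
    subset_insert n (m + l - 1) i S (subset_insert m l j T U)"
  proof (rule Set.set_eqI)
    fix p
    have shift: "p - (l' + m') = p - (m' + l')" "p - (l' + i') = p - (i' + l')"
      by (simp_all add: add.commute)
    \<comment> \<open>Here \<open>U\<close> sits inside \<open>T\<close>, so the five runs are \<open>S\<close>, \<open>T\<close>, \<open>U\<close>, \<open>T\<close>, \<open>S\<close>.\<close>
    consider "p \<le> i'" | "i' < p" "p \<le> i' + j'" | "i' + j' < p" "p \<le> i' + j' + l'"
      | "i' + j' + l' < p" "p \<le> i' + m' + l'" | "i' + m' + l' < p"
      by linarith
    then show "p \<in> subset_insert (n + m - 1) l (i + j - 1) (subset_insert n m i S T) U \<longleftrightarrow>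
      p \<in> subset_insert n (m + l - 1) i S (subset_insert m l j T U)"
      by cases (use order in \<open>simp_all add: pred iff shift le_diff_conv\<close>)
  qed
next
  fix n i :: nat and S
  assume "1 \<le> n" "1 \<le> i" "i \<le> n" "S \<in> subsets n"
  moreover have "{} \<in> subsets 1" by (simp add: subsets_def)
  ultimately show "subset_insert n 1 i S {} = S"
    by (intro Set.set_eqI) (auto simp: mem_subset_insert_iff)
next
  fix n :: nat and S
  assume "1 \<le> n" "S \<in> subsets n"
  then show "subset_insert 1 n 1 {} S = S"
    by (intro Set.set_eqI) (auto simp: subset_insert_def subsets_def)
next
  show "{} \<in> subsets 1" by (simp add: subsets_def)
qed (rule finite_subsets subset_insert_mem; assumption)+


section \<open>Insertion of permutations\<close>

text \<open>
  The effect on the letters of \<open>\<sigma>\<close> other than \<open>c\<close> when the value \<open>c\<close> is widened to \<open>m\<close> consecutive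
  values.
\<close>

definition raise :: "nat \<Rightarrow> nat \<Rightarrow> nat \<Rightarrow> nat" where
  "raise c m v = (if v < c then v else v + m - 1)"

text \<open>
  Splitting \<open>\<sigma>\<close> at the letter where the insertion takes place turns the associativity laws
  into letterwise identities.
\<close>

lemma perm_insert_append:
  assumes "length u = i - 1" "i \<ge> 1"
  shows "perm_insert i (u @ c # w) \<tau> =
    map (raise c (length \<tau>)) u @ map (\<lambda>k. k + c - 1) \<tau> @ map (raise c (length \<tau>)) w"
proof -
  have "drop i (u @ c # w) = w" using assms by (cases i) simp_all
  then show ?thesis
    using assms by (simp add: perm_insert_def raise_def[abs_def] Let_def nth_append)
qed

lemma perms_iff: "\<sigma> \<in> perms n \<longleftrightarrow> distinct \<sigma> \<and> set \<sigma> = {1..n}"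
  by (auto simp: perms_def permutations_of_set_def)

lemma length_perms: "\<sigma> \<in> perms n \<Longrightarrow> length \<sigma> = n"
  by (auto simp: perms_iff dest: distinct_card)

lemma split_at_position:
  assumes "length xs = n" "1 \<le> i" "i \<le> n"
  obtains u c w where "xs = u @ c # w" "length u = i - 1"
  using id_take_nth_drop[of "i - 1" xs] assms
  by (metis One_nat_def Suc_le_eq Suc_pred diff_less dual_order.strict_trans2 length_take less_imp_le_nat
      min.absorb2 zero_less_one le_less_trans diff_le_self)

text \<open>
  Both sides arise from \<open>u @ c # v @ d # w\<close> by replacing \<open>c\<close> and \<open>d\<close> with blocks, so they are equal
  block by block as soon as raising values around \<open>c\<close> and around \<open>d\<close> commute. Since \<open>c \<noteq> d\<close>, the
  letter around which the second insertion raises is the raised one, \<open>c'\<close> or \<open>d'\<close>.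
\<close>

lemma perm_insert_parallel:
  assumes "1 \<le> i" "i < j" "j \<le> n" "m \<ge> 1" "l \<ge> 1"
    and s: "\<sigma> \<in> perms n" and t: "\<tau> \<in> perms m" and r: "\<rho> \<in> perms l"
  shows "perm_insert (j + m - 1) (perm_insert i \<sigma> \<tau>) \<rho> = perm_insert i (perm_insert j \<sigma> \<rho>) \<tau>"
proof -
  obtain u' d w where 1: "\<sigma> = u' @ d # w" "length u' = j - 1"
    using split_at_position[OF length_perms[OF s], of j] assms by auto
  have "i \<le> j - 1" using \<open>i < j\<close> by simp
  then obtain u c v where 2: "u' = u @ c # v" "length u = i - 1"
    using split_at_position[OF 1(2) \<open>1 \<le> i\<close>] by blast
  have len: "length \<tau> = m" "length \<rho> = l" using t r length_perms by auto
  define c' d' where "c' = raise d l c" and "d' = raise c m d"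
  have cd: "c \<noteq> d" "1 \<le> c" "1 \<le> d"
    using s by (auto simp: perms_iff 1 2 dest!: equalityD1)
  have lv: "length v = j - 1 - i" using 1 2 assms by simp
  have outer: "raise d' l (raise c m k) = raise c' m (raise d l k)"
    if "k \<in> set u \<union> set v \<union> set w" for k
  proof -
    have "k \<noteq> c" "k \<noteq> d" using s that by (auto simp: perms_iff 1 2)
    then show ?thesis using cd assms by (auto simp: raise_def c'_def d'_def)
  qed
  have tau: "raise d' l (k + c - 1) = k + c' - 1" if "k \<in> set \<tau>" for k
    using that t cd assms by (auto simp: perms_iff raise_def c'_def d'_def)
  have rho: "k + d' - 1 = raise c' m (k + d - 1)" if "k \<in> set \<rho>" for k
    using that r cd assms by (auto simp: perms_iff raise_def c'_def d'_def)
  have "perm_insert i \<sigma> \<tau> = (map (raise c m) u @ map (\<lambda>k. k + c - 1) \<tau> @ map (raise c m) v) @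
      d' # map (raise c m) w"
    using perm_insert_append[of u i c "v @ d # w" \<tau>] assms by (simp add: 1 2 len d'_def)
  then have "perm_insert (j + m - 1) (perm_insert i \<sigma> \<tau>) \<rho> =
      map (raise d' l) (map (raise c m) u @ map (\<lambda>k. k + c - 1) \<tau> @ map (raise c m) v) @
      map (\<lambda>k. k + d' - 1) \<rho> @ map (raise d' l) (map (raise c m) w)"
    using perm_insert_append[of "map (raise c m) u @ map (\<lambda>k. k + c - 1) \<tau> @ map (raise c m) v"
        "j + m - 1" d' _ \<rho>] 2(2) lv assms(1-5) len by simp
  moreover have "perm_insert j \<sigma> \<rho> = map (raise d l) u @ c' #
      map (raise d l) v @ map (\<lambda>k. k + d - 1) \<rho> @ map (raise d l) w"
    using perm_insert_append[of u' j d w \<rho>] 1 assms by (simp add: 2 len c'_def)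
  then have "perm_insert i (perm_insert j \<sigma> \<rho>) \<tau> =
      map (\<lambda>k. raise c' m (raise d l k)) u @ map (\<lambda>k. k + c' - 1) \<tau> @
      map (\<lambda>k. raise c' m (raise d l k)) v @ map (\<lambda>k. raise c' m (k + d - 1)) \<rho> @
      map (\<lambda>k. raise c' m (raise d l k)) w"
    using assms by (simp add: perm_insert_append len 2 comp_def)
  ultimately show ?thesis
    using outer tau rho by (simp add: comp_def)
qed

text \<open>
  The letter \<open>d\<close> of \<open>\<tau>\<close> becomes \<open>d' = d + c - 1\<close> inside the inserted block, and it lies in the range
  of that block. Widening \<open>d'\<close> therefore moves a letter outside the block exactly when widening \<open>c\<close> did,
  and the two widenings add up to one by \<open>m + l - 1\<close> values.
\<close>

lemma perm_insert_sequential: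
  assumes "1 \<le> i" "i \<le> n" "1 \<le> j" "j \<le> m" "l \<ge> 1"
    and s: "\<sigma> \<in> perms n" and t: "\<tau> \<in> perms m" and r: "\<rho> \<in> perms l"
  shows "perm_insert (i + j - 1) (perm_insert i \<sigma> \<tau>) \<rho> = perm_insert i \<sigma> (perm_insert j \<tau> \<rho>)"
proof -
  obtain u c w where 1: "\<sigma> = u @ c # w" "length u = i - 1"
    using split_at_position[OF length_perms[OF s], of i] assms by auto
  obtain v d x where 2: "\<tau> = v @ d # x" "length v = j - 1"
    using split_at_position[OF length_perms[OF t], of j] assms by auto
  have len: "length \<tau> = m" "length \<rho> = l" using t r length_perms by auto
  have len': "length (perm_insert j \<tau> \<rho>) = m + l - 1"
    using perm_insert_mem[OF _ _ _ t r] assms length_perms by auto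
  have pos: "1 \<le> c" "1 \<le> d" "d \<le> m"
    using s t by (auto simp: perms_iff 1 2 dest!: equalityD1)
  define d' where "d' = d + c - 1"
  have outer: "raise d' l (raise c m k) = raise c (m + l - 1) k" if "k \<in> set u \<union> set w" for k
  proof -
    have "k \<noteq> c" using s that by (auto simp: perms_iff 1)
    then show ?thesis using pos assms by (auto simp: raise_def d'_def)
  qed
  have tau: "raise d' l (k + c - 1) = raise d l k + c - 1" if "k \<in> set v \<union> set x" for k
    using pos assms by (auto simp: raise_def d'_def)
  have rho: "k + d' - 1 = (k + d - 1) + c - 1" for k
    using pos by (simp add: d'_def)
  have "perm_insert i \<sigma> \<tau> = map (raise c m) u @ map (\<lambda>k. k + c - 1) \<tau> @ map (raise c m) w"
    using perm_insert_append[of u i c w \<tau>] 1 assms len by simp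
  also have "\<dots> = (map (raise c m) u @ map (\<lambda>k. k + c - 1) v) @
      d' # map (\<lambda>k. k + c - 1) x @ map (raise c m) w"
    by (simp add: 2(1) d'_def)
  finally have "perm_insert (i + j - 1) (perm_insert i \<sigma> \<tau>) \<rho> =
      map (raise d' l) (map (raise c m) u @ map (\<lambda>k. k + c - 1) v) @ map (\<lambda>k. k + d' - 1) \<rho> @
      map (raise d' l) (map (\<lambda>k. k + c - 1) x @ map (raise c m) w)"
    using perm_insert_append[of "map (raise c m) u @ map (\<lambda>k. k + c - 1) v" "i + j - 1" d' _ \<rho>]
      1(2) 2(2) assms(1-5) len(2) by simp
  moreover have "perm_insert i \<sigma> (perm_insert j \<tau> \<rho>) =
      map (raise c (m + l - 1)) u @ map (\<lambda>k. k + c - 1) (perm_insert j \<tau> \<rho>) @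
      map (raise c (m + l - 1)) w"
    using perm_insert_append[of u i c w "perm_insert j \<tau> \<rho>"] 1 assms len' by simp
  moreover have "perm_insert j \<tau> \<rho> =
      map (raise d l) v @ map (\<lambda>k. k + d - 1) \<rho> @ map (raise d l) x"
    using perm_insert_append[of v j d x \<rho>] 2 assms len by simp
  ultimately show ?thesis
    using outer tau rho by (simp add: comp_def)
qed

lemma set_operad_perms: "set_operad perms (\<lambda>n m. perm_insert) [1]"
proof
  fix n i :: nat and \<sigma>
  assume *: "1 \<le> n" "1 \<le> i" "i \<le> n" and s: "\<sigma> \<in> perms n"
  obtain u c w where "\<sigma> = u @ c # w" "length u = i - 1"
    using split_at_position[OF length_perms[OF s], of i] * by auto
  moreover have "raise c 1 = (\<lambda>v. v)"
    by (simp add: raise_def fun_eq_iff)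
  ultimately show "perm_insert i \<sigma> [1] = \<sigma>"
    using * by (simp add: perm_insert_append)
next
  fix n :: nat and \<sigma> :: "nat list"
  show "perm_insert 1 [1] \<sigma> = \<sigma>"
    using perm_insert_append[of "[]" 1 1 "[]" \<sigma>] by simp
next
  show "[1::nat] \<in> perms 1" by (simp add: perms_iff)
qed (rule finite_perms perm_insert_mem perm_insert_parallel perm_insert_sequential; assumption)+


section \<open>Descents\<close>

lemma nth_perm_insert:
  assumes "1 \<le> i" "i \<le> length \<sigma>" "q < length \<sigma> + length \<tau> - 1"
  shows "perm_insert i \<sigma> \<tau> ! q =
    (if q < i - 1 then raise (\<sigma> ! (i - 1)) (length \<tau>) (\<sigma> ! q)
     else if q < i - 1 + length \<tau> then \<tau> ! (q - (i - 1)) + \<sigma> ! (i - 1) - 1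
     else raise (\<sigma> ! (i - 1)) (length \<tau>) (\<sigma> ! (q + 1 - length \<tau>)))"
proof -
  have "i + (q - (i - 1 + length \<tau>)) = q + 1 - length \<tau>" if "\<not> q < i - 1 + length \<tau>"
    using that assms by simp
  then show ?thesis
    using assms by (auto simp: perm_insert_def Let_def raise_def nth_append min_def)
qed

lemma zero_not_mem_Des: "0 \<notin> Des \<sigma>"
  by (simp add: Des_def)

lemma Suc_mem_Des_iff: "Suc p \<in> Des \<sigma> \<longleftrightarrow> Suc p < length \<sigma> \<and> \<sigma> ! p > \<sigma> ! Suc p"
  by (auto simp: Des_def)

text \<open>
  The descent at a gap is determined by the two adjacent letters. If both belong to \<open>\<sigma>\<close> or both to
  \<open>\<tau>\<close>, their relabelling is strictly monotone. At either border of the block a letter of \<open>\<sigma>\<close>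
  meets a letter of the block, and the two compare as that letter does with \<open>c\<close>, since
  the block occupies the values from \<open>c\<close> to \<open>c + m - 1\<close>.
\<close>

lemma Des_perm_insert:
  assumes *: "1 \<le> i" "i \<le> n" "m \<ge> 1" and s: "\<sigma> \<in> perms n" and t: "\<tau> \<in> perms m"
  shows "Des (perm_insert i \<sigma> \<tau>) = subset_insert n m i (Des \<sigma>) (Des \<tau>)"
proof -
  obtain m' i' where pred: "m = Suc m'" "i = Suc i'"
    using * by (metis Suc_le_D One_nat_def)
  have i': "i' < n" using * by (simp add: pred)
  have len: "length \<sigma> = n" "length \<tau> = Suc m'" "length (perm_insert i \<sigma> \<tau>) = n + m'"
    using s t perm_insert_mem[OF * s t] length_perms by (auto simp: pred)
  define c where "c = \<sigma> ! i'"
  have ds: "distinct \<sigma>" "set \<sigma> = {1..n}" and st: "set \<tau> = {1..Suc m'}"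
    using s t by (simp_all add: perms_iff pred)
  have sig_neq: "\<sigma> ! q \<noteq> c" if "q < n" "q \<noteq> i'" for q
    using nth_eq_iff_index_eq[OF ds(1), of q i'] that i' by (simp add: len c_def)
  have tau: "1 \<le> \<tau> ! q" "\<tau> ! q \<le> Suc m'" if "q < Suc m'" for q
    using nth_mem[of q \<tau>] that by (simp_all add: len st)
  have c: "1 \<le> c" using nth_mem[of i' \<sigma>] i' by (simp add: len ds c_def)
  have mono: "raise c (Suc m') v > raise c (Suc m') w \<longleftrightarrow> v > w" for v w
    by (auto simp: raise_def)
  have mono': "v + c - Suc 0 > w + c - Suc 0 \<longleftrightarrow> v > w" for v w
    using c by auto
  have nth: "perm_insert i \<sigma> \<tau> ! q =
    (if q < i' then raise c (Suc m') (\<sigma> ! q)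
     else if q \<le> i' + m' then \<tau> ! (q - i') + c - Suc 0
     else raise c (Suc m') (\<sigma> ! (q - m')))" if "q < n + m'" for q
    using nth_perm_insert[of i \<sigma> q \<tau>] that * by (simp add: len c_def pred less_Suc_eq_le)
  have R: "p \<in> subset_insert n m i (Des \<sigma>) (Des \<tau>) \<longleftrightarrow>
    (if p \<le> i' then p \<in> Des \<sigma> else if p \<le> i' + m' then p - i' \<in> Des \<tau> else p - m' \<in> Des \<sigma>)" for p
    unfolding pred using Des_mem[OF s] Des_mem[OF t]
    by (intro mem_subset_insert_Suc_iff) (simp_all add: pred)
  show ?thesis
  proof (rule Set.set_eqI)
    fix p
    show "p \<in> Des (perm_insert i \<sigma> \<tau>) \<longleftrightarrow> p \<in> subset_insert n m i (Des \<sigma>) (Des \<tau>)"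
    proof (cases p)
      case 0
      then show ?thesis by (simp add: R zero_not_mem_Des)
    next
      case p: (Suc q)
      \<comment> \<open>The letters adjacent to the gap \<open>p\<close> have list positions \<open>q\<close> and \<open>Suc q\<close>. In cases 3 and 5
        the gap is the left or the right border of the block.\<close>
      consider "Suc q \<ge> n + m'"
        | "Suc q < n + m'" "Suc q < i'" | "Suc q < n + m'" "Suc q = i'"
        | "Suc q < n + m'" "i' \<le> q" "q < i' + m'" | "Suc q < n + m'" "q = i' + m'"
        | "Suc q < n + m'" "i' + m' < q"
        by linarith
      then show ?thesis
      proof cases
        case 1
        then have "Suc q - m' = Suc (q - m')" "i' + m' < Suc q" "\<not> Suc (q - m') < n"
          using i' by linarith+
        then show ?thesis
          using 1 unfolding p R by (simp add: Suc_mem_Des_iff len)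
      next
        case 2
        then show ?thesis
          using i' unfolding p R by (simp add: Suc_mem_Des_iff len nth mono)
      next
        case 3
        have "\<sigma> ! q \<noteq> c" using 3 i' by (intro sig_neq) linarith+
        then have "raise c (Suc m') (\<sigma> ! q) > \<tau> ! 0 + c - Suc 0 \<longleftrightarrow> \<sigma> ! q > c"
          using tau[of 0] c by (auto simp: raise_def)
        then show ?thesis
          using 3(1) i' unfolding p R by (simp add: Suc_mem_Des_iff len nth c_def 3(2)[symmetric])
      next
        case 4
        then show ?thesis
          unfolding p R by (simp add: Suc_mem_Des_iff len nth mono' Suc_diff_le less_diff_conv2)
      next
        case 5
        have "\<sigma> ! Suc i' \<noteq> c" using 5 by (intro sig_neq) linarith+
        then have "\<tau> ! m' + c - Suc 0 > raise c (Suc m') (\<sigma> ! Suc i') \<longleftrightarrow> c > \<sigma> ! Suc i'"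
          using tau[of m'] c by (auto simp: raise_def)
        moreover have "Suc q - m' = Suc i'" "q - i' = m'" using 5 by linarith+
        ultimately show ?thesis
          using 5(1) unfolding p R by (simp add: Suc_mem_Des_iff len nth c_def 5(2))
      next
        case 6
        then have "Suc q - m' = Suc (q - m')" "Suc (q - m') < n" by linarith+
        then show ?thesis
          using 6 unfolding p R by (simp add: Suc_mem_Des_iff len nth mono)
      qed
    qed
  qed
qed

lemma Des_snoc:
  "Des (xs @ [y]) = Des xs \<union> (if xs \<noteq> [] \<and> last xs > y then {length xs} else {})"
proof (rule Set.set_eqI)
  fix p
  show "p \<in> Des (xs @ [y]) \<longleftrightarrow> p \<in> Des xs \<union> (if xs \<noteq> [] \<and> last xs > y then {length xs} else {})"
  proof (cases p)
    case 0
    then show ?thesis by (simp add: zero_not_mem_Des)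
  next
    case p: (Suc q)
    consider "Suc q < length xs" | "length xs = Suc q" | "Suc q > length xs" by linarith
    then show ?thesis
    proof cases
      case 2
      then have "xs \<noteq> []" "last xs = xs ! q"
        using last_conv_nth[of xs] by (cases "xs = []"; simp)+
      then show ?thesis using 2 by (simp add: p Suc_mem_Des_iff nth_append)
    qed (simp_all add: p Suc_mem_Des_iff nth_append)
  qed
qed

lemma Des_map_Suc: "Des (map Suc xs) = Des xs"
  by (auto simp: Des_def)

text \<open>
  Induction on the length: a last letter that is smaller than all others creates a
  descent at the last gap, one that is larger does not, and neither affects the earlier gaps.
\<close>

lemma Des_surj:
  assumes "S \<in> subsets n"
  shows "\<exists>\<sigma>\<in>perms n. Des \<sigma> = S"
  using assms
proof (induction n arbitrary: S)
  case 0
  then show ?case by (auto simp: subsets_def perms_iff Des_def)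
next
  case (Suc n)
  have "S - {n} \<in> subsets n"
    using Suc.prems by (force simp: subsets_def)
  then obtain \<sigma> where s: "\<sigma> \<in> perms n" "Des \<sigma> = S - {n}"
    using Suc.IH by blast
  show ?case
  proof (cases "n \<in> S")
    case True
    then have "n \<ge> 1" using Suc.prems by (auto simp: subsets_def)
    then have "\<sigma> \<noteq> []" using length_perms[OF s(1)] by auto
    moreover from this have "last \<sigma> \<ge> 1" using s(1) by (metis atLeastAtMost_iff last_in_set perms_iff)
    ultimately have "Des (map Suc \<sigma> @ [1]) = S"
      using True s length_perms[OF s(1)] by (auto simp: Des_snoc Des_map_Suc last_map)
    moreover have "map Suc \<sigma> @ [1] \<in> perms (Suc n)"
      using s(1) by (auto simp: perms_iff distinct_map image_Suc_atLeastAtMost)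
    ultimately show ?thesis by blast
  next
    case False
    have "last \<sigma> \<le> n" if "\<sigma> \<noteq> []" using s(1) that by (metis atLeastAtMost_iff last_in_set perms_iff)
    then have "Des (\<sigma> @ [Suc n]) = S"
      using False s by (auto simp: Des_snoc)
    moreover have "\<sigma> @ [Suc n] \<in> perms (Suc n)"
      using s(1) by (auto simp: perms_iff)
    ultimately show ?thesis by blast
  qed
qed

theorem proposition3p2:
  fixes R :: "('k, 'r) ring_scheme"
  assumes "cring R"
  shows "ns_operad R (subset_operad R) \<and>
    ns_operad_morphism R (perm_operad R) (subset_operad R) (descent_map R) \<and>
    (\<forall>n\<ge>1. descent_map R n ` carrier (space (perm_operad R) n) = carrier (space (subset_operad R) n))"
proof -
  have subset: "subset_operad R = linearization R subsets subset_insert {}"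
    by (simp add: subset_operad_def linearization_def)
  have perm: "perm_operad R = linearization R perms (\<lambda>n m. perm_insert) [1]"
    by (simp add: perm_operad_def linearization_def)
  have D: "descent_map R = (\<lambda>n. linear_extension R (perms n) (subsets n) Des)"
    by (simp add: descent_map_def[abs_def] fun_eq_iff)
  have "ns_operad R (subset_operad R)"
    unfolding subset by (rule set_operad.ns_operad_linearization[OF set_operad_subsets assms])
  moreover have "ns_operad_morphism R (perm_operad R) (subset_operad R) (descent_map R)"
    unfolding subset perm D
    by (rule ns_operad_morphism_linearization[OF assms set_operad_perms set_operad_subsets])
       (simp_all add: Des_mem Des_perm_insert, simp add: Des_def)
  moreover have "descent_map R n ` carrier (space (perm_operad R) n) = carrier (space (subset_operad R) n)" for n
  proof -
    have "subsets n \<subseteq> Des ` perms n"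
      using Des_surj by blast
    then show ?thesis
      using linear_extension_surj[OF assms finite_perms finite_subsets]
      by (simp add: descent_map_def[abs_def] perm_operad_def subset_operad_def)
  qed
  ultimately show ?thesis by simp
qed

end
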